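(* Let $\rho>0$, let $p_i\in\mathbb{R}^2$ be an initial position and $\theta_i$ an initial heading, and let the target circle have center $C_t\in\mathbb{R}^2$ and radius $r_t=\rho$. Suppose that the distance between $p_i$ and every point of the target circle is greater than $4\rho$. Then the function $$D_{CSC}(\alpha)=\min\{D_{LSL}(\alpha),D_{LSR}(\alpha),D_{RSR}(\alpha),D_{RSL}(\alpha)\}$$ is continuous on its domain $\alpha\in[0,2\pi]$.
   Context: A point of the target circle is specified by its angular position $\alpha$, measured counter-clockwise from the positive $x$-axis: it is the point $C_t+r_t(\cos\alpha,\sin\alpha)$. The rotational direction on the target circle is clockwise, so the final heading required at angular position $\alpha$ is $\theta=\alpha-\frac{\pi}{2}$ (the clockwise tangent direction). Headings are angles measured counter-clockwise from the positive $x$-axis. CSC paths. Let S denote a straight line segment, L a counter-clockwise (left-turning) circular arc of radius $\rho$, and R a clockwise (right-turning) circular arc of radius $\rho$. For a word $W\in\{LSL,LSR,RSR,RSL\}$, the path of type $W$ to $\alpha$ is the continuously differentiable path from position $p_i$ with heading $\theta_i$ to position $C_t+r_t(\cos\alpha,\sin\alpha)$ with heading $\alpha-\frac{\pi}{2}$ which is a concatenation of three segments (arc, straight segment, arc) of the types indicated by $W$, traversed forward, where the angles $\phi_1^W(\alpha),\phi_2^W(\alpha)$ of the first and second arcs are taken in $[0,2\pi)$ (computed modulo $2\pi$) and the straight segment has length $L_S^W(\alpha)\ge 0$. Its length is $D_W(\alpha)=\rho\,\phi_1^W(\alpha)+L_S^W(\alpha)+\rho\,\phi_2^W(\alpha)$.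 Under the hypothesis that $p_i$ is at distance greater than $4\rho$ from every point of the target circle, all four paths exist for every $\alpha$. The value at $\alpha=2\pi$ is that at $\alpha=0$, i.e. $D_{CSC}$ is viewed as a $2\pi$-periodic function of $\alpha$. *)

theory Defs
  imports "HOL-Analysis.Analysis"
begin

text \<open>
  The Euclidean plane is identified with \<^typ>\<open>complex\<close>, so that the unit vector with heading \<open>\<theta>\<close>
  (counter-clockwise from the positive \<open>x\<close>-axis) is \<open>cis \<theta>\<close> and distances are \<^const>\<open>dist\<close>.
  Paths are parametrised by arc length.
\<close>

datatype turn = LeftTurn | RightTurn

datatype csc_word = LSL | LSR | RSR | RSL

fun first_turn :: "csc_word \<Rightarrow> turn" where
  "first_turn LSL = LeftTurn"
| "first_turn LSR = LeftTurn"
| "first_turn RSR = RightTurn"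
| "first_turn RSL = RightTurn"

fun last_turn :: "csc_word \<Rightarrow> turn" where
  "last_turn LSL = LeftTurn"
| "last_turn LSR = RightTurn"
| "last_turn RSR = RightTurn"
| "last_turn RSL = LeftTurn"

fun turn_sign :: "turn \<Rightarrow> real" where
  "turn_sign LeftTurn = 1"
| "turn_sign RightTurn = -1"

text \<open>
  On the time interval \<open>[a, b]\<close>, \<open>\<gamma>\<close> runs at unit speed along a circle of radius \<open>\<rho>\<close> (centre \<open>c\<close>,
  initial polar angle \<open>s\<close>), counter-clockwise for a left and clockwise for a right turn;
  the angle swept is \<open>(b - a) / \<rho>\<close>.
\<close>

definition arc_on :: "turn \<Rightarrow> real \<Rightarrow> (real \<Rightarrow> complex) \<Rightarrow> real \<Rightarrow> real \<Rightarrow> bool" where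
  "arc_on T \<rho> \<gamma> a b \<longleftrightarrow>
     (\<exists>c s. \<forall>t\<in>{a..b}. \<gamma> t = c + complex_of_real \<rho> * cis (s + turn_sign T * ((t - a) / \<rho>)))"

definition segment_on :: "(real \<Rightarrow> complex) \<Rightarrow> real \<Rightarrow> real \<Rightarrow> bool" where
  "segment_on \<gamma> a b \<longleftrightarrow>
     (\<exists>z u. norm u = 1 \<and> (\<forall>t\<in>{a..b}. \<gamma> t = z + (t - a) *\<^sub>R u))"

text \<open>
  \<open>\<gamma>\<close>, restricted to \<open>[0, \<rho> * \<phi>1 + l + \<rho> * \<phi>2]\<close>, is a continuously differentiable path of type \<open>W\<close>
  from position \<open>p\<close> with heading \<open>\<theta>\<close> to position \<open>q\<close> with heading \<open>\<theta>'\<close>, with arc angles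
  \<open>\<phi>1\<close>, \<open>\<phi>2\<close> and straight part of length \<open>l\<close>.  The values of \<open>\<gamma>\<close> outside this interval play no role:
  they only serve to make the two-sided derivatives at the end points meaningful.
\<close>

definition is_csc_path ::
  "csc_word \<Rightarrow> real \<Rightarrow> complex \<Rightarrow> real \<Rightarrow> complex \<Rightarrow> real \<Rightarrow> real \<Rightarrow> real \<Rightarrow> real \<Rightarrow> (real \<Rightarrow> complex) \<Rightarrow> bool"
  where
  "is_csc_path W \<rho> p \<theta> q \<theta>' \<phi>1 l \<phi>2 \<gamma> \<longleftrightarrow>
     \<phi>1 \<in> {0..<2 * pi} \<and> 0 \<le> l \<and> \<phi>2 \<in> {0..<2 * pi} \<and>
     \<gamma> C1_differentiable_on {0..\<rho> * \<phi>1 + l + \<rho> * \<phi>2} \<and>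
     \<gamma> 0 = p \<and> (\<gamma> has_vector_derivative cis \<theta>) (at 0) \<and>
     \<gamma> (\<rho> * \<phi>1 + l + \<rho> * \<phi>2) = q \<and>
     (\<gamma> has_vector_derivative cis \<theta>') (at (\<rho> * \<phi>1 + l + \<rho> * \<phi>2)) \<and>
     arc_on (first_turn W) \<rho> \<gamma> 0 (\<rho> * \<phi>1) \<and>
     segment_on \<gamma> (\<rho> * \<phi>1) (\<rho> * \<phi>1 + l) \<and>
     arc_on (last_turn W) \<rho> \<gamma> (\<rho> * \<phi>1 + l) (\<rho> * \<phi>1 + l + \<rho> * \<phi>2)"

definition target_point :: "complex \<Rightarrow> real \<Rightarrow> real \<Rightarrow> complex" where
  "target_point Ct rt \<alpha> = Ct + complex_of_real rt * cis \<alpha>"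

text \<open>
  The parameters \<open>(\<phi>1, l, \<phi>2)\<close> of the path of type \<open>W\<close> to \<open>\<alpha>\<close>; the target circle is traversed
  clockwise.  They are meaningful whenever such a path exists and has uniquely determined
  parameters, which is the case if \<open>p\<close> has distance greater than \<open>4 * \<rho>\<close> from every point of a
  target circle of radius \<open>\<rho> > 0\<close>.
\<close>

definition csc_params ::
  "csc_word \<Rightarrow> real \<Rightarrow> complex \<Rightarrow> real \<Rightarrow> complex \<Rightarrow> real \<Rightarrow> real \<Rightarrow> real \<times> real \<times> real" where
  "csc_params W \<rho> p \<theta> Ct rt \<alpha> =
     (THE (\<phi>1, l, \<phi>2). \<exists>\<gamma>. is_csc_path W \<rho> p \<theta> (target_point Ct rt \<alpha>) (\<alpha> - pi / 2) \<phi>1 l \<phi>2 \<gamma>)"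

definition csc_length ::
  "csc_word \<Rightarrow> real \<Rightarrow> complex \<Rightarrow> real \<Rightarrow> complex \<Rightarrow> real \<Rightarrow> real \<Rightarrow> real" where
  "csc_length W \<rho> p \<theta> Ct rt \<alpha> =
     (case csc_params W \<rho> p \<theta> Ct rt \<alpha> of (\<phi>1, l, \<phi>2) \<Rightarrow> \<rho> * \<phi>1 + l + \<rho> * \<phi>2)"

definition D_CSC ::
  "real \<Rightarrow> complex \<Rightarrow> real \<Rightarrow> complex \<Rightarrow> real \<Rightarrow> real \<Rightarrow> real" where
  "D_CSC \<rho> p \<theta> Ct rt \<alpha> =
     Min {csc_length LSL \<rho> p \<theta> Ct rt \<alpha>, csc_length LSR \<rho> p \<theta> Ct rt \<alpha>,
          csc_length RSR \<rho> p \<theta> Ct rt \<alpha>, csc_length RSL \<rho> p \<theta> Ct rt \<alpha>}"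

lemma D_CSC_periodic: "D_CSC \<rho> p \<theta> Ct rt (\<alpha> + 2 * pi) = D_CSC \<rho> p \<theta> Ct rt \<alpha>"
proof -
  have per: "cis (x + 2 * pi) = cis x" for x
    by (simp flip: cis_mult)
  have "cis (\<alpha> + 2 * pi - pi / 2) = cis (\<alpha> - pi / 2)"
    using per[of "\<alpha> - pi / 2"] by (simp only: diff_add_eq)
  with per show ?thesis
    by (simp only: D_CSC_def csc_length_def csc_params_def is_csc_path_def target_point_def)
qed

end

theory Submission
  imports Defs
begin

text \<open>
  The length of one type of path jumps: an arc angle taken in \<open>[0, 2\<pi>)\<close> leaps from \<open>0\<close> to almost
  \<open>2\<pi>\<close> when the arc shrinks to nothing and would have to turn backwards. The minimum over the four
  types does not jump, because at such a moment a path of another type has the same length, and it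
  has the opposite turn where the first one degenerates.

  To see this, the lengths are first put in closed form. Headings are unit complex numbers: \<open>e\<close> at
  the start, \<open>w\<close> at the end \<open>q\<close>, and \<open>u\<close> along the straight segment. Let \<open>\<sigma>\<^sub>1\<close>, \<open>\<sigma>\<^sub>2\<close> be \<open>1\<close> for a left
  and \<open>-1\<close> for a right turn. A path with segment length \<open>l\<close> has turning centres \<open>c\<^sub>1 = p + \<i>\<sigma>\<^sub>1\<rho>e\<close>
  and \<open>c\<^sub>2 = q + \<i>\<sigma>\<^sub>2\<rho>w\<close>, and summing up the three pieces gives \<open>c\<^sub>2 - c\<^sub>1 = (l + \<i>(\<sigma>\<^sub>2 - \<sigma>\<^sub>1)\<rho>) u\<close>
  (\<open>ex_csc_path_iff\<close>). Since \<open>\<bar>c\<^sub>2 - c\<^sub>1\<bar> > 2\<rho>\<close>, this determines \<open>l > 0\<close> and \<open>u\<close>, which depend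
  continuously on \<open>q\<close> and \<open>w\<close> (\<open>ex_csc_path_iff_closed_form\<close>). The arc angles are the arguments in
  \<open>[0, 2\<pi>)\<close> of \<open>u / e\<close> and \<open>w / u\<close>, or of their conjugates for right turns.

  The argument in \<open>[0, 2\<pi>)\<close> is lower semicontinuous, hence so are the four lengths and their minimum.
  For upper semicontinuity at a limit target \<open>(q\<^sub>0, w\<^sub>0)\<close>, it suffices to find, for each nearby target,
  a type that attains the minimum in the limit and whose arcs that vanish in the limit now turn in the
  proper direction, so that their angles are near \<open>0\<close> and not near \<open>2\<pi>\<close> (\<open>eventually_ex_fair\<close>).
  If the first arc of a minimal type vanishes, the straight line starts at \<open>p\<close> with direction \<open>e\<close>, and it
  is the same for both choices of the first turn. Nearby, \<open>u\<close> lies to the left or to the right of \<open>e\<close>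
  according to the side of the initial tangent line on which the final turning circle has moved
  (\<open>eventually_sgn_first_turn\<close>). This side does not depend on the first turn, so that a left or a right
  first arc is the proper one. The last arc is treated in the same way. If both arcs vanish, all four
  types coincide in the limit, and a comparison of signs shows that one of them is always proper
  (\<open>ex_fair_word\<close>).

  Continuity is proved for final poses that depend continuously on a parameter and stay further than
  \<open>4\<rho>\<close> from \<open>p\<close>; a point moving on the target circle, with its clockwise tangent, is an instance.
\<close>

section \<open>Existence of paths with given parameters\<close>

lemma cis_quarter_turn: "cis (s - turn_sign T * (pi / 2)) = - (\<i> * turn_sign T * cis s)"
  by (cases T) (auto simp: complex_eq_iff cos_diff sin_diff cos_add sin_add)

lemma vector_derivative_unique_closed_interval:
  fixes f g :: "real \<Rightarrow> 'a::euclidean_space"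
  assumes "a < b" "x \<in> {a..b}"
    and eq: "\<And>t. t \<in> {a..b} \<Longrightarrow> f t = g t"
    and f: "(f has_vector_derivative f') (at x)"
    and g: "(g has_vector_derivative g') (at x)"
  shows "f' = g'"
proof (rule vector_derivative_unique_within_closed_interval[of a b x])
  show "(f has_vector_derivative f') (at x within cbox a b)"
    using f has_vector_derivative_at_within by blast
  show "(f has_vector_derivative g') (at x within cbox a b)"
    by (rule has_vector_derivative_transform[OF _ _ has_vector_derivative_at_within[OF g]])
       (use assms in auto)
qed (use assms in auto)

text \<open>Displacement after running for a time \<open>t\<close> along an arc entered with heading \<open>\<eta>\<close>.\<close>
definition arc_end :: "turn \<Rightarrow> real \<Rightarrow> real \<Rightarrow> real \<Rightarrow> complex" where
  "arc_end T \<rho> \<eta> t = turn_sign T * \<i> * \<rho> * (cis \<eta> - cis (\<eta> + turn_sign T * (t / \<rho>)))"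

lemma arc_end_0 [simp]: "arc_end T \<rho> \<eta> 0 = 0"
  by (simp add: arc_end_def)

lemma has_vector_derivative_cis:
  assumes "(f has_real_derivative f') (at x)"
  shows "((\<lambda>x. cis (f x)) has_vector_derivative f' *\<^sub>R (\<i> * cis (f x))) (at x)"
  using has_derivative_cis[OF assms[unfolded has_field_derivative_def]]
  by (simp add: has_vector_derivative_def mult.commute)

lemma has_vector_derivative_arc_end:
  assumes "\<rho> > 0"
  shows "(arc_end T \<rho> \<eta> has_vector_derivative cis (\<eta> + turn_sign T * (t / \<rho>))) (at t)"
proof -
  have "((\<lambda>t. turn_sign T * \<i> * \<rho> * (cis \<eta> - cis (\<eta> + turn_sign T * (t / \<rho>))))
          has_vector_derivative (turn_sign T * \<i> * \<rho> * (0 - (turn_sign T / \<rho>) *\<^sub>R (\<i> * cis (\<eta> + turn_sign T * (t / \<rho>)))))) (at t)"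
    by (intro has_vector_derivative_mult_right has_vector_derivative_diff has_vector_derivative_const
        has_vector_derivative_cis) (use assms in \<open>auto intro!: derivative_eq_intros\<close>)
  moreover have "turn_sign T * \<i> * \<rho> * (0 - (turn_sign T / \<rho>) *\<^sub>R (\<i> * z)) = z" for z
    using assms by (cases T) (auto simp: scaleR_conv_of_real)
  ultimately show ?thesis
    by (simp add: arc_end_def[abs_def])
qed

text \<open>
  An arc of positive duration is determined by its turn and the heading at its start. The differentiability at
  both ends carries this over to \<open>a = b\<close>, where \<^const>\<open>arc_on\<close> by itself says nothing about headings:
  the derivatives at the two ends are then the same. So vanishing arcs need no separate treatment.
\<close>
lemma arc_on_imp:
  assumes "\<rho> > 0" "a \<le> b" "arc_on T \<rho> \<gamma> a b"
    and start: "(\<gamma> has_vector_derivative cis \<eta>) (at a)"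
    and stop: "(\<gamma> has_vector_derivative d) (at b)"
  shows "\<gamma> b = \<gamma> a + arc_end T \<rho> \<eta> (b - a)" "d = cis (\<eta> + turn_sign T * ((b - a) / \<rho>))"
proof -
  have "\<gamma> b = \<gamma> a + arc_end T \<rho> \<eta> (b - a) \<and> d = cis (\<eta> + turn_sign T * ((b - a) / \<rho>))"
  proof (cases "a = b")
    case True
    then show ?thesis
      using vector_derivative_unique_at[OF start] stop by auto
  next
    case False
    then have "a < b" using assms by simp
    obtain c s where \<gamma>: "\<And>t. t \<in> {a..b} \<Longrightarrow> \<gamma> t = c + \<rho> * cis (s + turn_sign T * ((t - a) / \<rho>))"
      using assms(3) unfolding arc_on_def by blast
    \<comment> \<open>The tangent of a circle is a quarter turn ahead of the radius.\<close>
    define \<eta>' where "\<eta>' = s + turn_sign T * (pi / 2)"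
    have s: "cis (s + x) = - (\<i> * turn_sign T * cis (\<eta>' + x))" for x
      using cis_quarter_turn[of "\<eta>' + x" T] by (simp add: \<eta>'_def algebra_simps)
    have arc: "\<gamma> t = \<gamma> a + arc_end T \<rho> \<eta>' (t - a)" if "t \<in> {a..b}" for t
      using \<gamma>[OF that] \<gamma>[of a] \<open>a < b\<close> s[of 0]
      by (simp add: s arc_end_def algebra_simps)
    have deriv: "((\<lambda>t. \<gamma> a + arc_end T \<rho> \<eta>' (t - a)) has_vector_derivative
            cis (\<eta>' + turn_sign T * ((t - a) / \<rho>))) (at t)" for t
    proof -
      have "((\<lambda>t. t - a) has_vector_derivative 1) (at t)"
        by (auto intro!: derivative_eq_intros)
      from vector_diff_chain_at[OF this has_vector_derivative_arc_end[OF \<open>\<rho> > 0\<close>]]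
      show ?thesis
        by (auto simp: o_def intro!: derivative_eq_intros)
    qed
    have "cis \<eta> = cis \<eta>'"
      using vector_derivative_unique_closed_interval[OF \<open>a < b\<close> _ arc start deriv] \<open>a < b\<close> by simp
    moreover have "d = cis (\<eta>' + turn_sign T * ((b - a) / \<rho>))"
      using vector_derivative_unique_closed_interval[OF \<open>a < b\<close> _ arc stop deriv] \<open>a < b\<close> by simp
    ultimately show ?thesis
      using arc[of b] \<open>a < b\<close> by (simp add: arc_end_def flip: cis_mult)
  qed
  then show "\<gamma> b = \<gamma> a + arc_end T \<rho> \<eta> (b - a)" "d = cis (\<eta> + turn_sign T * ((b - a) / \<rho>))"
    by auto
qed

lemma segment_on_imp:
  assumes "a \<le> b" "segment_on \<gamma> a b"
    and start: "(\<gamma> has_vector_derivative d) (at a)"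
    and stop: "(\<gamma> has_vector_derivative d') (at b)"
  shows "\<gamma> b = \<gamma> a + (b - a) *\<^sub>R d" "d' = d"
proof -
  have "\<gamma> b = \<gamma> a + (b - a) *\<^sub>R d \<and> d' = d"
  proof (cases "a = b")
    case True
    then show ?thesis
      using vector_derivative_unique_at[OF start] stop by auto
  next
    case False
    then have "a < b" using assms by simp
    obtain z u where \<gamma>: "\<And>t. t \<in> {a..b} \<Longrightarrow> \<gamma> t = z + (t - a) *\<^sub>R u"
      using assms(2) unfolding segment_on_def by blast
    have deriv: "((\<lambda>t. z + (t - a) *\<^sub>R u) has_vector_derivative u) (at t)" for t
      by (auto intro!: derivative_eq_intros)
    have "d = u"
      using vector_derivative_unique_closed_interval[OF \<open>a < b\<close> _ \<gamma> start deriv] \<open>a < b\<close> by simp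
    moreover have "d' = u"
      using vector_derivative_unique_closed_interval[OF \<open>a < b\<close> _ \<gamma> stop deriv] \<open>a < b\<close> by simp
    ultimately show ?thesis
      using \<gamma>[of a] \<gamma>[of b] \<open>a < b\<close> by simp
  qed
  then show "\<gamma> b = \<gamma> a + (b - a) *\<^sub>R d" "d' = d" by auto
qed

text \<open>The path is assembled from three motions defined at all times, cut at the two junctions.\<close>
lemma has_vector_derivative_glue:
  fixes f g :: "real \<Rightarrow> 'a::real_normed_vector"
  assumes f: "\<And>t. (f has_vector_derivative f' t) (at t)"
    and g: "\<And>t. (g has_vector_derivative g' t) (at t)"
    and "f a = g a" "f' a = g' a"
  shows "((\<lambda>t. if t \<le> a then f t else g t) has_vector_derivative (if t \<le> a then f' t else g' t)) (at t)"
proof -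
  have eq: "f t = g t" "f' t = g' t" if "a = t" for t
    using assms that by auto
  have "((\<lambda>t. if t \<in> {..a} then f t else g t) has_vector_derivative
          (if t \<in> {..a} then f' t else g' t)) (at t within UNIV)"
    by (rule has_vector_derivative_If_within_closures[where T = "{a<..}"])
       (use eq in \<open>auto simp: f g intro: has_vector_derivative_at_within\<close>)
  then show ?thesis by simp
qed

text \<open>
  The way from the first turning centre to the second one leads along a radius to the start of the segment,
  then along the segment, then along a radius of the second circle. The two radii are perpendicular to the
  segment: they cancel for equal turns, and add up to length \<open>2\<rho>\<close> for opposite ones. This is the equation
  for the centres. Conversely, under the two equations the three pieces fit together with matching headings.
\<close>
lemma ex_csc_path_iff:
  assumes "\<rho> > 0" "\<phi>1 \<in> {0..<2 * pi}" "0 \<le> l" "\<phi>2 \<in> {0..<2 * pi}"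
  shows "(\<exists>\<gamma>. is_csc_path W \<rho> p \<theta> q \<theta>' \<phi>1 l \<phi>2 \<gamma>) \<longleftrightarrow>
    (let \<sigma>1 = turn_sign (first_turn W); \<sigma>2 = turn_sign (last_turn W); \<psi> = \<theta> + \<sigma>1 * \<phi>1 in
     cis (\<psi> + \<sigma>2 * \<phi>2) = cis \<theta>' \<and>
     (q + \<sigma>2 * \<i> * \<rho> * cis \<theta>') - (p + \<sigma>1 * \<i> * \<rho> * cis \<theta>) = Complex l ((\<sigma>2 - \<sigma>1) * \<rho>) * cis \<psi>)"
proof -
  define X where "X = first_turn W"
  define Y where "Y = last_turn W"
  define \<psi> where "\<psi> = \<theta> + turn_sign X * \<phi>1"
  define a where "a = \<rho> * \<phi>1"
  define b where "b = a + l"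
  define T where "T = b + \<rho> * \<phi>2"
  have le: "0 \<le> a" "a \<le> b" "b \<le> T" and
    ar: "a / \<rho> = \<phi>1" "(T - b) / \<rho> = \<phi>2" and bl: "b - a = l"
    using assms by (auto simp: a_def b_def T_def)
  define final where "final = p + arc_end X \<rho> \<theta> a + l *\<^sub>R cis \<psi> + arc_end Y \<rho> \<psi> (T - b)"
  have closed: "cis (\<psi> + turn_sign Y * \<phi>2) = cis \<theta>' \<and> final = q \<longleftrightarrow>
     cis (\<psi> + turn_sign Y * \<phi>2) = cis \<theta>' \<and>
     (q + turn_sign Y * \<i> * \<rho> * cis \<theta>') - (p + turn_sign X * \<i> * \<rho> * cis \<theta>) = Complex l ((turn_sign Y - turn_sign X) * \<rho>) * cis \<psi>"
    unfolding final_def arc_end_def ar Complex_eq \<psi>_def[symmetric]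
    by (auto simp: scaleR_conv_of_real algebra_simps)
  have "(\<exists>\<gamma>. is_csc_path W \<rho> p \<theta> q \<theta>' \<phi>1 l \<phi>2 \<gamma>) \<longleftrightarrow> cis (\<psi> + turn_sign Y * \<phi>2) = cis \<theta>' \<and> final = q"
  proof
    assume "\<exists>\<gamma>. is_csc_path W \<rho> p \<theta> q \<theta>' \<phi>1 l \<phi>2 \<gamma>"
    then obtain \<gamma> where "is_csc_path W \<rho> p \<theta> q \<theta>' \<phi>1 l \<phi>2 \<gamma>" ..
    then have C1: "\<gamma> C1_differentiable_on {0..T}" and st: "\<gamma> 0 = p" "(\<gamma> has_vector_derivative cis \<theta>) (at 0)"
      and fi: "\<gamma> T = q" "(\<gamma> has_vector_derivative cis \<theta>') (at T)"
      and pieces: "arc_on X \<rho> \<gamma> 0 a" "segment_on \<gamma> a b" "arc_on Y \<rho> \<gamma> b T"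
      unfolding is_csc_path_def X_def Y_def a_def b_def T_def by auto
    obtain D where D: "\<And>t. t \<in> {0..T} \<Longrightarrow> (\<gamma> has_vector_derivative D t) (at t)"
      using C1 unfolding C1_differentiable_on_def by blast
    have Da: "(\<gamma> has_vector_derivative D a) (at a)" and Db: "(\<gamma> has_vector_derivative D b) (at b)"
      using D le by auto
    note arc1 = arc_on_imp[OF \<open>\<rho> > 0\<close> \<open>0 \<le> a\<close> pieces(1) st(2) Da]
    note seg = segment_on_imp[OF \<open>a \<le> b\<close> pieces(2) Da Db]
    have "D a = cis \<psi>" using arc1(2) by (simp add: ar \<psi>_def)
    with seg(2) Db have "(\<gamma> has_vector_derivative cis \<psi>) (at b)" by simp
    note arc2 = arc_on_imp[OF \<open>\<rho> > 0\<close> \<open>b \<le> T\<close> pieces(3) this fi(2)]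
    show "cis (\<psi> + turn_sign Y * \<phi>2) = cis \<theta>' \<and> final = q"
      using arc1 seg arc2 st fi \<open>D a = cis \<psi>\<close> by (simp add: final_def ar bl)
  next
    assume R: "cis (\<psi> + turn_sign Y * \<phi>2) = cis \<theta>' \<and> final = q"
    define g1 where "g1 t = p + arc_end X \<rho> \<theta> t" for t
    define g2 where "g2 t = g1 a + (t - a) *\<^sub>R cis \<psi>" for t
    define g3 where "g3 t = g2 b + arc_end Y \<rho> \<psi> (t - b)" for t
    define d1 where "d1 t = cis (\<theta> + turn_sign X * (t / \<rho>))" for t
    define d3 where "d3 t = cis (\<psi> + turn_sign Y * ((t - b) / \<rho>))" for t
    define g23 where "g23 t = (if t \<le> b then g2 t else g3 t)" for t
    define d23 where "d23 t = (if t \<le> b then cis \<psi> else d3 t)" for t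
    define \<gamma> where "\<gamma> t = (if t \<le> a then g1 t else g23 t)" for t
    define \<gamma>' where "\<gamma>' t = (if t \<le> a then d1 t else d23 t)" for t
    have g1: "(g1 has_vector_derivative d1 t) (at t)" for t
      unfolding g1_def d1_def by (auto intro!: derivative_eq_intros has_vector_derivative_arc_end \<open>\<rho> > 0\<close>)
    have g2: "(g2 has_vector_derivative cis \<psi>) (at t)" for t
      unfolding g2_def by (auto intro!: derivative_eq_intros)
    have g3: "(g3 has_vector_derivative d3 t) (at t)" for t
    proof -
      have "((\<lambda>t. t - b) has_vector_derivative 1) (at t)"
        by (auto intro!: derivative_eq_intros)
      from vector_diff_chain_at[OF this has_vector_derivative_arc_end[OF \<open>\<rho> > 0\<close>]]
      show ?thesis
        unfolding g3_def d3_def by (auto simp: o_def intro!: derivative_eq_intros)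
    qed
    have g23: "(g23 has_vector_derivative d23 t) (at t)" for t
      unfolding g23_def d23_def
      by (rule has_vector_derivative_glue[OF g2 g3]) (auto simp: g3_def d3_def)
    have \<gamma>: "(\<gamma> has_vector_derivative \<gamma>' t) (at t)" for t
      unfolding \<gamma>_def \<gamma>'_def
      by (rule has_vector_derivative_glue[OF g1 g23])
         (use le ar in \<open>auto simp: g23_def d23_def g2_def d1_def \<psi>_def\<close>)
    have "continuous_on UNIV d23"
      unfolding d23_def
      by (rule continuous_on_cases_le[where h = "\<lambda>t. t"])
         (use \<open>\<rho> > 0\<close> in \<open>auto simp: d3_def intro!: continuous_intros\<close>)
    then have "continuous_on UNIV \<gamma>'"
      unfolding \<gamma>'_def
      by (intro continuous_on_cases_le[where h = "\<lambda>t. t"])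
         (use le ar \<open>\<rho> > 0\<close> in \<open>auto simp: d1_def d23_def \<psi>_def intro!: continuous_intros elim: continuous_on_subset\<close>)
    then have C1: "\<gamma> C1_differentiable_on S" for S
      unfolding C1_differentiable_on_def using \<gamma> continuous_on_subset by blast
    have arc: "arc_on U \<rho> (\<lambda>t. z + arc_end U \<rho> \<eta> (t - s)) s e" for U z \<eta> s e
      unfolding arc_on_def arc_end_def
    proof (intro exI ballI)
      fix t
      show "z + turn_sign U * \<i> * \<rho> * (cis \<eta> - cis (\<eta> + turn_sign U * ((t - s) / \<rho>))) =
         (z + turn_sign U * \<i> * \<rho> * cis \<eta>) + \<rho> * cis ((\<eta> - turn_sign U * (pi / 2)) + turn_sign U * ((t - s) / \<rho>))"
        using cis_quarter_turn[of "\<eta> + turn_sign U * ((t - s) / \<rho>)" U]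
        by (simp add: algebra_simps)
    qed
    have on1: "\<gamma> t = p + arc_end X \<rho> \<theta> (t - 0)" if "t \<in> {0..a}" for t
      using that by (simp add: \<gamma>_def g1_def)
    have on2: "\<gamma> t = g1 a + (t - a) *\<^sub>R cis \<psi>" if "t \<in> {a..b}" for t
      using that by (auto simp: \<gamma>_def g23_def g2_def)
    have on3: "\<gamma> t = g2 b + arc_end Y \<rho> \<psi> (t - b)" if "t \<in> {b..T}" for t
      using that le by (auto simp: \<gamma>_def g23_def g2_def g3_def)
    have "arc_on X \<rho> \<gamma> 0 a" "arc_on Y \<rho> \<gamma> b T"
      using arc[of X p \<theta> 0 a] arc[of Y "g2 b" \<psi> b T] on1 on3 unfolding arc_on_def by auto
    moreover have "segment_on \<gamma> a b"
      unfolding segment_on_def using on2 by (intro exI[of _ "g1 a"] exI[of _ "cis \<psi>"]) auto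
    moreover have "\<gamma> 0 = p" using on1[of 0] le by simp
    moreover have "\<gamma> T = q" using on3[of T] le R by (simp add: final_def g2_def g1_def bl)
    moreover have "\<gamma>' 0 = cis \<theta>" using le by (simp add: \<gamma>'_def d1_def)
    \<comment> \<open>If the last arc is empty, \<open>\<gamma>' T\<close> is taken from the segment, or from the first arc if the segment is empty too.\<close>
    moreover have "\<gamma>' T = cis (\<psi> + turn_sign Y * \<phi>2)"
    proof -
      consider "b < T" | "b = T" "a < b" | "b = T" "a = b" using le by linarith
      then show ?thesis
        by cases (use le ar in \<open>auto simp: \<gamma>'_def d23_def d3_def d1_def \<psi>_def\<close>)
    qed
    ultimately have "is_csc_path W \<rho> p \<theta> q \<theta>' \<phi>1 l \<phi>2 \<gamma>"
      using assms \<gamma>[of 0] \<gamma>[of T] C1 R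
      unfolding is_csc_path_def X_def[symmetric] Y_def[symmetric] a_def[symmetric] b_def[symmetric] T_def[symmetric]
      by simp
    then show "\<exists>\<gamma>. is_csc_path W \<rho> p \<theta> q \<theta>' \<phi>1 l \<phi>2 \<gamma>" by blast
  qed
  with closed show ?thesis
    unfolding Let_def X_def[symmetric] Y_def[symmetric] \<psi>_def[symmetric] by simp
qed

section \<open>The angle swept by a turn\<close>

text \<open>The angle in \<open>[0, 2\<pi>)\<close> by which a left or right turn rotates the heading \<open>1\<close> into \<open>z\<close>.\<close>
definition swept :: "turn \<Rightarrow> complex \<Rightarrow> real" where
  "swept T z = Arg2pi (case T of LeftTurn \<Rightarrow> z | RightTurn \<Rightarrow> cnj z)"

lemma swept_1 [simp]: "swept T 1 = 0"
  by (cases T) (auto simp: swept_def Arg2pi_eq_0)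

lemma swept_bounds: "swept T z \<in> {0..<2 * pi}"
  using Arg2pi[of "case T of LeftTurn \<Rightarrow> z | RightTurn \<Rightarrow> cnj z"] by (simp add: swept_def)

lemma cis_Arg2pi: "norm z = 1 \<Longrightarrow> cis (Arg2pi z) = z"
  using complex_norm_eq_1_exp cis_conv_exp by metis

lemma Arg2pi_cis: "\<phi> \<in> {0..<2 * pi} \<Longrightarrow> Arg2pi (cis \<phi>) = \<phi>"
  by (rule Arg2pi_unique[of 1]) (auto simp: cis_conv_exp)

lemma cis_turn_eq_iff:
  assumes "norm z = 1" "\<phi> \<in> {0..<2 * pi}"
  shows "cis (turn_sign T * \<phi>) = z \<longleftrightarrow> \<phi> = swept T z"
proof (cases T)
  case LeftTurn
  then show ?thesis
    using assms cis_Arg2pi[of z] Arg2pi_cis[of \<phi>] by (auto simp: swept_def)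
next
  case RightTurn
  have "cis (- \<phi>) = z \<longleftrightarrow> cis \<phi> = cnj z"
    by (metis cis_cnj complex_cnj_cnj)
  then show ?thesis
    using RightTurn assms cis_Arg2pi[of "cnj z"] Arg2pi_cis[of \<phi>] by (auto simp: swept_def)
qed

text \<open>
  The swept angle is lower semicontinuous: it jumps only on the nonnegative real axis, where it takes
  its least value \<open>0\<close>.
\<close>
lemma eventually_swept_gt:
  assumes "(f \<longlongrightarrow> z0) F" "y < swept T z0"
  shows "\<forall>\<^sub>F x in F. y < swept T (f x)"
proof -
  define t where "t z = (case T of LeftTurn \<Rightarrow> z | RightTurn \<Rightarrow> cnj z)" for z
  have "((\<lambda>x. t (f x)) \<longlongrightarrow> t z0) F"
    using assms(1) by (cases T) (auto simp: t_def intro: tendsto_intros)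
  moreover have "t z0 \<in> {z. y < Arg2pi z}"
    using assms(2) by (simp add: swept_def t_def)
  ultimately have "\<forall>\<^sub>F x in F. t (f x) \<in> {z. y < Arg2pi z}"
    using open_Arg2pi2pi_gt topological_tendstoD by blast
  then show ?thesis by (simp add: swept_def t_def)
qed

text \<open>
  At \<open>z0 = 1\<close> upper semicontinuity holds from one side only, the one that a short turn in the prescribed
  direction reaches.
\<close>
lemma eventually_swept_lt:
  assumes "(f \<longlongrightarrow> z0) F" "norm z0 = 1" "swept T z0 < y"
  shows "\<forall>\<^sub>F x in F. (z0 = 1 \<longrightarrow> 0 \<le> turn_sign T * Im (f x)) \<longrightarrow> swept T (f x) < y"
proof -
  define t where "t z = (case T of LeftTurn \<Rightarrow> z | RightTurn \<Rightarrow> cnj z)" for z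
  have lim: "((\<lambda>x. t (f x)) \<longlongrightarrow> t z0) F"
    using assms(1) by (cases T) (auto simp: t_def intro: tendsto_intros)
  have [simp]: "t z = 1 \<longleftrightarrow> z = 1" and Im: "Im (t z) = turn_sign T * Im z" for z
    by (cases T; auto simp: t_def)+
  have swept_t: "swept T z = Arg2pi (t z)" for z
    by (simp add: swept_def t_def)
  have nrm: "norm (t z0) = 1"
    using assms(2) by (cases T) (auto simp: t_def)
  define S where "S = (if z0 = 1 then {z. 0 \<le> Im z} else UNIV)"
  have "continuous (at (t z0) within S) Arg2pi"
  proof (cases "z0 = 1")
    case True
    have "t z0 \<noteq> 0" using nrm by auto
    then show ?thesis
      using continuous_within_upperhalf_Arg2pi True by (simp add: S_def)
  next
    case False
    have "t z0 \<notin> \<real>\<^sub>\<ge>\<^sub>0"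
    proof
      assume "t z0 \<in> \<real>\<^sub>\<ge>\<^sub>0"
      then obtain r where "t z0 = of_real r" "0 \<le> r"
        by (auto elim: nonneg_Reals_cases)
      with nrm have "t z0 = 1" by simp
      with False show False by simp
    qed
    then show ?thesis
      using continuous_at_Arg2pi False by (simp add: S_def)
  qed
  moreover have "Arg2pi (t z0) < y" using assms(3) by (simp add: swept_def t_def)
  ultimately have "\<forall>\<^sub>F z in at (t z0) within S. Arg2pi z < y"
    unfolding continuous_within using order_tendstoD(2) by blast
  then have "\<forall>\<^sub>F z in nhds (t z0). z \<in> S \<longrightarrow> Arg2pi z < y"
    unfolding eventually_at_filter
    by (rule eventually_mono) (use \<open>Arg2pi (t z0) < y\<close> in auto)
  then have "\<forall>\<^sub>F x in F. t (f x) \<in> S \<longrightarrow> Arg2pi (t (f x)) < y"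
    using lim by (rule eventually_compose_filterlim)
  then show ?thesis
    by (rule eventually_mono) (auto simp: S_def Im swept_t)
qed

section \<open>Tangent segments of turning circles\<close>

text \<open>
  The solution of \<open>s = (l + \<i>k) u\<close> with \<open>l \<ge> 0\<close> and \<open>\<bar>u\<bar> = 1\<close>. For \<open>s\<close> joining the centres of the turning
  circles and \<open>k\<close> the component of \<open>s\<close> perpendicular to the segment, \<open>l\<close> and \<open>u\<close> are the length and
  the direction of the common tangent segment.
\<close>
definition offset_length :: "real \<Rightarrow> complex \<Rightarrow> real" where
  "offset_length k s = sqrt ((norm s)\<^sup>2 - k\<^sup>2)"

definition offset_dir :: "real \<Rightarrow> complex \<Rightarrow> complex" where
  "offset_dir k s = s / Complex (offset_length k s) k"

lemma offset_length_pos: "\<bar>k\<bar> < norm s \<Longrightarrow> 0 < offset_length k s"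
  unfolding offset_length_def
  by (metis abs_norm_cancel diff_gt_0_iff_gt power2_abs power2_strict_mono real_sqrt_gt_zero abs_abs)

lemma norm_Complex_offset:
  assumes "\<bar>k\<bar> < norm s"
  shows "norm (Complex (offset_length k s) k) = norm s"
proof -
  have "0 \<le> (norm s)\<^sup>2 - k\<^sup>2"
    using offset_length_pos[OF assms] by (auto simp: offset_length_def)
  then show ?thesis
    by (simp add: offset_length_def cmod_def)
qed

lemma norm_offset_dir:
  assumes "\<bar>k\<bar> < norm s"
  shows "norm (offset_dir k s) = 1"
  using assms norm_Complex_offset[OF assms] by (auto simp: offset_dir_def norm_divide)

lemma offset_eq_iff:
  assumes "\<bar>k\<bar> < norm s" "0 \<le> l" "norm u = 1"
  shows "s = Complex l k * u \<longleftrightarrow> l = offset_length k s \<and> u = offset_dir k s"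
proof
  assume s: "s = Complex l k * u"
  then have "(norm s)\<^sup>2 = l\<^sup>2 + k\<^sup>2"
    using assms(3) by (simp add: norm_mult power_mult_distrib cmod_power2)
  then have l: "l = offset_length k s"
    using assms by (simp add: offset_length_def)
  moreover have "Complex l k \<noteq> 0"
    using offset_length_pos[OF assms(1)] l by (simp add: complex_eq_iff)
  ultimately show "l = offset_length k s \<and> u = offset_dir k s"
    using s by (simp add: offset_dir_def nonzero_eq_divide_eq mult.commute)
next
  have "Complex (offset_length k s) k \<noteq> 0"
    using offset_length_pos[OF assms(1)] by (simp add: complex_eq_iff)
  then show "s = Complex l k * u" if "l = offset_length k s \<and> u = offset_dir k s"
    using that by (simp add: offset_dir_def)
qed

text \<open>
  The formula \<open>1 - Re y = (Im y)\<^sup>2 / (1 + Re y)\<close> turns \<open>Im ((l + \<i>k) y) - k\<close> into the product of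
  \<open>Im y\<close> and \<open>l - k Im y / (1 + Re y)\<close>, whose second factor is positive. With \<open>y\<close> the direction of the
  segment in the frame of the initial or final heading, the sign on the left says on which side of the
  tangent line the opposite turning circle lies.
\<close>
lemma sgn_Im_offset:
  assumes "norm y = 1" "0 < Re y" "\<bar>k * Im y\<bar> < l"
  shows "sgn (Im (Complex l k * y) - k) = sgn (Im y)"
proof -
  have "(Re y)\<^sup>2 + (Im y)\<^sup>2 = 1"
    using assms(1) by (metis cmod_power2 one_power2)
  then have "(1 + Re y) * (Im (Complex l k * y) - k) = Im y * (l * (1 + Re y) - k * Im y)"
    by (simp add: algebra_simps power2_eq_square) algebra
  moreover have "0 < l * (1 + Re y) - k * Im y"
  proof -
    have "l * 1 \<le> l * (1 + Re y)"
      using assms by (intro mult_left_mono) auto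
    then show ?thesis using assms(3) by linarith
  qed
  ultimately have "sgn (1 + Re y) * sgn (Im (Complex l k * y) - k) = sgn (Im y) * 1"
    by (metis sgn_mult sgn_pos)
  then show ?thesis using assms(2) by simp
qed

section \<open>Choosing the turns by signs\<close>

text \<open>
  A word is good if neither of its arcs has to turn the wrong way. In the application, all headings are
  close to each other, and \<open>a X Y\<close>, \<open>b X Y\<close> and \<open>h\<close> have the signs of the turns from the initial heading to
  the segment, from the segment to the final heading, and in total.
  The sign of the first turn depends only on the type of the second one, and conversely. For \<open>h \<le> 0\<close> no
  word has two positive turns. So if RR is bad at its start, LR is good; if it is bad at its end,
  RL is good. For \<open>h > 0\<close> exchange left and right.
\<close>
lemma ex_fair_word:
  fixes a b :: "turn \<Rightarrow> turn \<Rightarrow> real" and s t :: "turn \<Rightarrow> real"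
  assumes a: "\<And>X Y. sgn (a X Y) = sgn (s Y)" and b: "\<And>X Y. sgn (b X Y) = - sgn (t X)"
    and pos: "\<And>X Y. 0 < a X Y \<Longrightarrow> 0 < b X Y \<Longrightarrow> 0 < h"
    and neg: "\<And>X Y. a X Y < 0 \<Longrightarrow> b X Y < 0 \<Longrightarrow> h < (0 :: real)"
  shows "\<exists>X Y. 0 \<le> turn_sign X * a X Y \<and> 0 \<le> turn_sign Y * b X Y"
proof -
  have as: "0 < a X Y \<longleftrightarrow> 0 < s Y" "a X Y < 0 \<longleftrightarrow> s Y < 0" for X Y
    using a[of X Y] by (metis sgn_greater, metis sgn_less)
  have bt: "0 < b X Y \<longleftrightarrow> t X < 0" "b X Y < 0 \<longleftrightarrow> 0 < t X" for X Y
    using b[of X Y] by (metis neg_0_less_iff_less sgn_greater sgn_less, metis neg_less_0_iff_less sgn_greater sgn_less)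
  have sgn0: "0 \<le> turn_sign LeftTurn * c \<longleftrightarrow> \<not> c < 0" "0 \<le> turn_sign RightTurn * c \<longleftrightarrow> \<not> 0 < c" for c
    by auto
  note pos' = pos[unfolded as bt] and neg' = neg[unfolded as bt]
  show ?thesis
  proof (cases "0 < h")
    case False
    consider "0 < s RightTurn" | "\<not> 0 < s RightTurn" "\<not> t RightTurn < 0" | "t RightTurn < 0" by blast
    then show ?thesis
    proof cases
      case 1
      then show ?thesis using False pos'
        by (intro exI[of _ LeftTurn] exI[of _ RightTurn]) (auto simp only: sgn0 as bt)
    next
      case 2
      then show ?thesis
        by (intro exI[of _ RightTurn] exI[of _ RightTurn]) (auto simp only: sgn0 as bt)
    next
      case 3
      then show ?thesis using False pos'
        by (intro exI[of _ RightTurn] exI[of _ LeftTurn]) (auto simp only: sgn0 as bt)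
    qed
  next
    case True
    then have "\<not> h < 0" by simp
    consider "s LeftTurn < 0" | "\<not> s LeftTurn < 0" "\<not> 0 < t LeftTurn" | "0 < t LeftTurn" by blast
    then show ?thesis
    proof cases
      case 1
      then show ?thesis using \<open>\<not> h < 0\<close> neg'
        by (intro exI[of _ RightTurn] exI[of _ LeftTurn]) (auto simp only: sgn0 as bt)
    next
      case 2
      then show ?thesis
        by (intro exI[of _ LeftTurn] exI[of _ LeftTurn]) (auto simp only: sgn0 as bt)
    next
      case 3
      then show ?thesis using \<open>\<not> h < 0\<close> neg'
        by (intro exI[of _ LeftTurn] exI[of _ RightTurn]) (auto simp only: sgn0 as bt)
    qed
  qed
qed

lemma eventually_all_turns:
  assumes "\<And>X :: turn. \<forall>\<^sub>F x in F. P X x"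
  shows "\<forall>\<^sub>F x in F. \<forall>X. P X x"
  using assms[of LeftTurn] assms[of RightTurn]
proof eventually_elim
  case (elim x)
  then have "P X x" for X by (cases X) simp_all
  then show ?case by blast
qed

lemma ex_turn_sign: "\<exists>X. 0 \<le> turn_sign X * c"
proof (cases "0 \<le> c")
  case True
  then show ?thesis by (intro exI[of _ LeftTurn]) simp
next
  case False
  then show ?thesis by (intro exI[of _ RightTurn]) simp
qed

section \<open>Path lengths in closed form\<close>

text \<open>Products of complex numbers are to be kept as such, and not expanded into coordinates.\<close>
declare times_complex.sel [simp del]

locale initial_pose =
  fixes \<rho> :: real and p e :: complex
  assumes radius_pos: "\<rho> > 0" and norm_e: "norm e = 1"
begin

definition centre_shift :: "turn \<Rightarrow> turn \<Rightarrow> complex \<Rightarrow> complex \<Rightarrow> complex" where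
  "centre_shift X Y q w = (q + turn_sign Y * \<i> * \<rho> * w) - (p + turn_sign X * \<i> * \<rho> * e)"

definition tangent_offset :: "turn \<Rightarrow> turn \<Rightarrow> real" where
  "tangent_offset X Y = (turn_sign Y - turn_sign X) * \<rho>"

definition line_length :: "turn \<Rightarrow> turn \<Rightarrow> complex \<Rightarrow> complex \<Rightarrow> real" where
  "line_length X Y q w = offset_length (tangent_offset X Y) (centre_shift X Y q w)"

definition line_dir :: "turn \<Rightarrow> turn \<Rightarrow> complex \<Rightarrow> complex \<Rightarrow> complex" where
  "line_dir X Y q w = offset_dir (tangent_offset X Y) (centre_shift X Y q w)"

definition route_length :: "turn \<Rightarrow> turn \<Rightarrow> complex \<Rightarrow> complex \<Rightarrow> real" where
  "route_length X Y q w = \<rho> * swept X (line_dir X Y q w * cnj e) + line_length X Y q w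
     + \<rho> * swept Y (w * cnj (line_dir X Y q w))"

definition shortest :: "complex \<Rightarrow> complex \<Rightarrow> real" where
  "shortest q w = Min {route_length LeftTurn LeftTurn q w, route_length LeftTurn RightTurn q w,
     route_length RightTurn RightTurn q w, route_length RightTurn LeftTurn q w}"

lemma tangent_offset_less:
  assumes "norm w = 1" "4 * \<rho> < dist p q"
  shows "\<bar>tangent_offset X Y\<bar> < norm (centre_shift X Y q w)"
proof -
  have n: "norm (turn_sign Z * \<i> * \<rho> * v) = \<rho>" if "norm v = 1" for Z v
    using that radius_pos by (cases Z) (auto simp: norm_mult)
  have "dist p q = norm (centre_shift X Y q w - turn_sign Y * \<i> * \<rho> * w + turn_sign X * \<i> * \<rho> * e)"
    by (simp add: centre_shift_def dist_norm norm_minus_commute)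
  also have "\<dots> \<le> norm (centre_shift X Y q w) + \<rho> + \<rho>"
    using n[OF assms(1), of Y] n[OF norm_e, of X]
    by (metis (no_types, opaque_lifting) add_mono_thms_linordered_semiring(3) norm_triangle_ineq norm_triangle_ineq4 order_trans)
  finally have "2 * \<rho> < norm (centre_shift X Y q w)" using assms(2) by linarith
  moreover have "\<bar>tangent_offset X Y\<bar> \<le> 2 * \<rho>"
    using radius_pos by (cases X; cases Y) (auto simp: tangent_offset_def)
  ultimately show ?thesis by linarith
qed

lemma line_facts:
  assumes "norm w = 1" "4 * \<rho> < dist p q"
  shows norm_line_dir: "norm (line_dir X Y q w) = 1"
    and line_length_pos: "0 < line_length X Y q w"
    and centre_shift_eq: "centre_shift X Y q w = Complex (line_length X Y q w) (tangent_offset X Y) * line_dir X Y q w"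
proof -
  note less = tangent_offset_less[OF assms, of X Y]
  show unit: "norm (line_dir X Y q w) = 1" and pos: "0 < line_length X Y q w"
    using norm_offset_dir[OF less] offset_length_pos[OF less] by (simp_all add: line_dir_def line_length_def)
  show "centre_shift X Y q w = Complex (line_length X Y q w) (tangent_offset X Y) * line_dir X Y q w"
    using offset_eq_iff[OF less less_imp_le[OF pos] unit] by (simp add: line_dir_def line_length_def)
qed

lemma line_eqI:
  assumes "norm w = 1" "4 * \<rho> < dist p q" "0 \<le> l" "norm u = 1"
    and "centre_shift X Y q w = Complex l (tangent_offset X Y) * u"
  shows "line_length X Y q w = l" "line_dir X Y q w = u"
  using offset_eq_iff[OF tangent_offset_less[OF assms(1,2), of X Y] assms(3,4)] assms(5)
  by (auto simp: line_dir_def line_length_def)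

text \<open>
  A path without first arc starts straight away, so that it has the same line for either first turn.
\<close>
lemma line_from_start_indep:
  assumes "norm w = 1" "4 * \<rho> < dist p q" "line_dir X Y q w = e"
  shows "line_length X' Y q w = line_length X Y q w" "line_dir X' Y q w = e"
proof -
  have "centre_shift X' Y q w = centre_shift X Y q w + (turn_sign X - turn_sign X') * \<i> * \<rho> * e"
    by (simp add: centre_shift_def algebra_simps)
  also have "\<dots> = Complex (line_length X Y q w) (tangent_offset X' Y) * e"
    using centre_shift_eq[OF assms(1,2), of X Y] assms(3)
    by (simp add: tangent_offset_def Complex_eq algebra_simps)
  finally show "line_length X' Y q w = line_length X Y q w" "line_dir X' Y q w = e"
    using line_eqI[OF assms(1,2) less_imp_le[OF line_length_pos[OF assms(1,2)]] norm_e] by auto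
qed

lemma line_to_end_indep:
  assumes "norm w = 1" "4 * \<rho> < dist p q" "line_dir X Y q w = w"
  shows "line_length X Y' q w = line_length X Y q w" "line_dir X Y' q w = w"
proof -
  have "centre_shift X Y' q w = centre_shift X Y q w + (turn_sign Y' - turn_sign Y) * \<i> * \<rho> * w"
    by (simp add: centre_shift_def algebra_simps)
  also have "\<dots> = Complex (line_length X Y q w) (tangent_offset X Y') * w"
    using centre_shift_eq[OF assms(1,2), of X Y] assms(3)
    by (simp add: tangent_offset_def Complex_eq algebra_simps)
  finally show "line_length X Y' q w = line_length X Y q w" "line_dir X Y' q w = w"
    using line_eqI[OF assms(1,2) less_imp_le[OF line_length_pos[OF assms(1,2)]] assms(1)] by auto
qed

text \<open>
  The height of the final turning circle above the line through \<open>p\<close> with direction \<open>e\<close>, relative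
  to the position in which the circle touches this line with the right orientation; below,
  the height of the initial turning circle with respect to the final tangent line, taken in the same way but
  with opposite sign.
\<close>
definition start_side :: "turn \<Rightarrow> complex \<Rightarrow> complex \<Rightarrow> real" where
  "start_side Y q w = Im ((q + turn_sign Y * \<i> * \<rho> * w - p) * cnj e) - turn_sign Y * \<rho>"

definition end_side :: "turn \<Rightarrow> complex \<Rightarrow> complex \<Rightarrow> real" where
  "end_side X q w = Im ((q - p - turn_sign X * \<i> * \<rho> * e) * cnj w) + turn_sign X * \<rho>"

lemma mult_cnj_unit: "norm z = 1 \<Longrightarrow> z * cnj z = 1"
  by (simp flip: complex_norm_square)

lemma mult_cnj_eq_1_iff: "norm z = 1 \<Longrightarrow> z' * cnj z = 1 \<longleftrightarrow> z' = z"
  by (metis mult.assoc mult.commute mult.right_neutral mult_cnj_unit)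

lemma Im_real_i_real: "Im (of_real a * \<i> * of_real b) = a * b"
  by (simp add: times_complex.sel)

lemma start_side_eq:
  "start_side Y q w = Im (centre_shift X Y q w * cnj e) - tangent_offset X Y"
proof -
  have "centre_shift X Y q w * cnj e = (q + turn_sign Y * \<i> * \<rho> * w - p) * cnj e - turn_sign X * \<i> * \<rho> * (e * cnj e)"
    by (simp add: centre_shift_def algebra_simps)
  then show ?thesis
    by (simp add: start_side_def tangent_offset_def mult_cnj_unit norm_e Im_real_i_real left_diff_distrib)
qed

lemma end_side_eq:
  assumes "norm w = 1"
  shows "end_side X q w = Im (centre_shift X Y q w * cnj w) - tangent_offset X Y"
proof -
  have "centre_shift X Y q w * cnj w = (q - p - turn_sign X * \<i> * \<rho> * e) * cnj w + turn_sign Y * \<i> * \<rho> * (w * cnj w)"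
    by (simp add: centre_shift_def algebra_simps)
  then show ?thesis
    by (simp add: end_side_def tangent_offset_def mult_cnj_unit assms Im_real_i_real left_diff_distrib)
qed

end

section \<open>Continuity of the shortest length\<close>

locale moving_target = initial_pose +
  fixes F :: "'a filter" and q w :: "'a \<Rightarrow> complex" and q0 w0 :: complex
  assumes q_lim: "(q \<longlongrightarrow> q0) F" and w_lim: "(w \<longlongrightarrow> w0) F"
    and norm_w: "\<And>x. norm (w x) = 1" and norm_w0: "norm w0 = 1"
    and far: "\<And>x. 4 * \<rho> < dist p (q x)" and far0: "4 * \<rho> < dist p q0"
begin

lemma tendsto_centre_shift: "((\<lambda>x. centre_shift X Y (q x) (w x)) \<longlongrightarrow> centre_shift X Y q0 w0) F"
  unfolding centre_shift_def by (intro tendsto_intros q_lim w_lim)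

lemma tendsto_line_length: "((\<lambda>x. line_length X Y (q x) (w x)) \<longlongrightarrow> line_length X Y q0 w0) F"
  unfolding line_length_def offset_length_def by (intro tendsto_intros tendsto_centre_shift)

lemma tendsto_line_dir: "((\<lambda>x. line_dir X Y (q x) (w x)) \<longlongrightarrow> line_dir X Y q0 w0) F"
proof -
  have "Complex (line_length X Y q0 w0) k \<noteq> 0" for k
    using line_length_pos[OF norm_w0 far0, of X Y] by (simp add: complex_eq_iff)
  then show ?thesis
    using tendsto_line_length[of X Y]
    unfolding line_dir_def offset_dir_def line_length_def[symmetric]
    by (intro tendsto_intros tendsto_centre_shift tendsto_Complex) auto
qed

lemma tendsto_first_turn:
  "((\<lambda>x. line_dir X Y (q x) (w x) * cnj e) \<longlongrightarrow> line_dir X Y q0 w0 * cnj e) F"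
  by (intro tendsto_intros tendsto_line_dir)

lemma tendsto_last_turn:
  "((\<lambda>x. w x * cnj (line_dir X Y (q x) (w x))) \<longlongrightarrow> w0 * cnj (line_dir X Y q0 w0)) F"
  by (intro tendsto_intros tendsto_line_dir w_lim)

lemma eventually_sgn_Im_offset:
  assumes y: "(y \<longlongrightarrow> 1) F" "\<And>x. norm (y x) = 1" and l: "(l \<longlongrightarrow> l0) F" "0 < l0"
  shows "\<forall>\<^sub>F x in F. sgn (Im (Complex (l x) k * y x) - k) = sgn (Im (y x))"
proof -
  have "((\<lambda>x. Re (y x)) \<longlongrightarrow> Re 1) F"
    by (intro tendsto_intros y)
  then have "\<forall>\<^sub>F x in F. 0 < Re (y x)"
    by (rule order_tendstoD) simp
  moreover have "((\<lambda>x. l x - \<bar>k * Im (y x)\<bar>) \<longlongrightarrow> l0 - \<bar>k * Im 1\<bar>) F"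
    by (intro tendsto_intros y l)
  then have "\<forall>\<^sub>F x in F. 0 < l x - \<bar>k * Im (y x)\<bar>"
    by (rule order_tendstoD) (use l in simp)
  ultimately show ?thesis
  proof eventually_elim
    case (elim x)
    then show ?case by (intro sgn_Im_offset y) auto
  qed
qed

text \<open>
  The right-hand side does not mention \<open>X\<close>: with a left and with a right first arc, the segment turns to the
  same side of \<open>e\<close>. If the left arc would have to turn backwards, the right arc is short, and conversely.
\<close>
lemma eventually_sgn_first_turn:
  assumes "line_dir X Y q0 w0 = e"
  shows "\<forall>\<^sub>F x in F. sgn (Im (line_dir X Y (q x) (w x) * cnj e)) = sgn (start_side Y (q x) (w x))"
proof -
  have lim: "((\<lambda>x. line_dir X Y (q x) (w x) * cnj e) \<longlongrightarrow> 1) F"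
    using tendsto_first_turn[of X Y] assms by (simp add: mult_cnj_unit norm_e)
  have "norm (line_dir X Y (q x) (w x) * cnj e) = 1" for x
    by (simp add: norm_mult norm_line_dir[OF norm_w far] norm_e)
  from eventually_sgn_Im_offset[OF lim this tendsto_line_length line_length_pos[OF norm_w0 far0], of X Y "tangent_offset X Y"]
  show ?thesis
    by eventually_elim (simp add: start_side_eq[of Y _ _ X] centre_shift_eq[OF norm_w far] mult.assoc)
qed

lemma eventually_sgn_last_turn:
  assumes "line_dir X Y q0 w0 = w0"
  shows "\<forall>\<^sub>F x in F. sgn (Im (w x * cnj (line_dir X Y (q x) (w x)))) = - sgn (end_side X (q x) (w x))"
proof -
  have "((\<lambda>x. line_dir X Y (q x) (w x) * cnj (w x)) \<longlongrightarrow> line_dir X Y q0 w0 * cnj w0) F"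
    by (intro tendsto_intros tendsto_line_dir w_lim)
  then have lim: "((\<lambda>x. line_dir X Y (q x) (w x) * cnj (w x)) \<longlongrightarrow> 1) F"
    using assms by (simp add: mult_cnj_unit norm_w0)
  have flip: "Im (w x * cnj (line_dir X Y (q x) (w x))) = - Im (line_dir X Y (q x) (w x) * cnj (w x))" for x
    by (simp add: times_complex.sel)
  have "norm (line_dir X Y (q x) (w x) * cnj (w x)) = 1" for x
    by (simp add: norm_mult norm_line_dir[OF norm_w far] norm_w)
  from eventually_sgn_Im_offset[OF lim this tendsto_line_length line_length_pos[OF norm_w0 far0], of X Y "tangent_offset X Y"]
  show ?thesis
    unfolding flip sgn_minus
    by eventually_elim (simp add: end_side_eq[OF norm_w, of X _ _ Y] centre_shift_eq[OF norm_w far] mult.assoc)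
qed

text \<open>
  No arc that vanishes in the limit has to turn backwards. These are the arcs whose angle could be close
  to \<open>2\<pi>\<close> although the angle of the limit is \<open>0\<close>.
\<close>
definition turns_fairly :: "turn \<Rightarrow> turn \<Rightarrow> 'a \<Rightarrow> bool" where
  "turns_fairly X Y x \<longleftrightarrow>
     (line_dir X Y q0 w0 = e \<longrightarrow> 0 \<le> turn_sign X * Im (line_dir X Y (q x) (w x) * cnj e)) \<and>
     (line_dir X Y q0 w0 = w0 \<longrightarrow> 0 \<le> turn_sign Y * Im (w x * cnj (line_dir X Y (q x) (w x))))"

lemma eventually_route_length_gt:
  assumes "y < route_length X Y q0 w0"
  shows "\<forall>\<^sub>F x in F. y < route_length X Y (q x) (w x)"
proof -
  \<comment> \<open>The segment and the two arc angles may each lose \<open>\<epsilon>\<close>.\<close>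
  define \<epsilon> where "\<epsilon> = (route_length X Y q0 w0 - y) / (2 * \<rho> + 1)"
  have \<epsilon>: "0 < \<epsilon>" "y = route_length X Y q0 w0 - (\<rho> * \<epsilon> + \<epsilon> + \<rho> * \<epsilon>)"
  proof -
    show "0 < \<epsilon>" using assms radius_pos by (simp add: \<epsilon>_def)
    have "(2 * \<rho> + 1) * \<epsilon> = route_length X Y q0 w0 - y" using radius_pos by (simp add: \<epsilon>_def)
    then show "y = route_length X Y q0 w0 - (\<rho> * \<epsilon> + \<epsilon> + \<rho> * \<epsilon>)" by (simp add: algebra_simps)
  qed
  have "\<forall>\<^sub>F x in F. line_length X Y q0 w0 - \<epsilon> < line_length X Y (q x) (w x)"
    using tendsto_line_length[of X Y] \<epsilon>(1) by (intro order_tendstoD) auto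
  moreover have "\<forall>\<^sub>F x in F. swept X (line_dir X Y q0 w0 * cnj e) - \<epsilon> < swept X (line_dir X Y (q x) (w x) * cnj e)"
    using \<epsilon>(1) by (intro eventually_swept_gt[OF tendsto_first_turn]) simp
  moreover have "\<forall>\<^sub>F x in F. swept Y (w0 * cnj (line_dir X Y q0 w0)) - \<epsilon> < swept Y (w x * cnj (line_dir X Y (q x) (w x)))"
    using \<epsilon>(1) by (intro eventually_swept_gt[OF tendsto_last_turn]) simp
  ultimately show ?thesis
  proof eventually_elim
    case (elim x)
    then show ?case
      using elim(1) mult_strict_left_mono[OF elim(2) radius_pos] mult_strict_left_mono[OF elim(3) radius_pos]
      unfolding \<epsilon>(2) route_length_def right_diff_distrib by linarith
  qed
qed

lemma eventually_route_length_lt: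
  assumes "route_length X Y q0 w0 < y"
  shows "\<forall>\<^sub>F x in F. turns_fairly X Y x \<longrightarrow> route_length X Y (q x) (w x) < y"
proof -
  define \<epsilon> where "\<epsilon> = (y - route_length X Y q0 w0) / (2 * \<rho> + 1)"
  have \<epsilon>: "0 < \<epsilon>" "y = route_length X Y q0 w0 + (\<rho> * \<epsilon> + \<epsilon> + \<rho> * \<epsilon>)"
  proof -
    show "0 < \<epsilon>" using assms radius_pos by (simp add: \<epsilon>_def)
    have "(2 * \<rho> + 1) * \<epsilon> = y - route_length X Y q0 w0" using radius_pos by (simp add: \<epsilon>_def)
    then show "y = route_length X Y q0 w0 + (\<rho> * \<epsilon> + \<epsilon> + \<rho> * \<epsilon>)" by (simp add: algebra_simps)
  qed
  note n = norm_line_dir[OF norm_w0 far0, of X Y]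
  have first: "line_dir X Y q0 w0 * cnj e = 1 \<longleftrightarrow> line_dir X Y q0 w0 = e"
    and last: "w0 * cnj (line_dir X Y q0 w0) = 1 \<longleftrightarrow> line_dir X Y q0 w0 = w0"
    using mult_cnj_eq_1_iff[OF norm_e] mult_cnj_eq_1_iff[OF n] by auto
  have "\<forall>\<^sub>F x in F. line_length X Y (q x) (w x) < line_length X Y q0 w0 + \<epsilon>"
    using tendsto_line_length[of X Y] \<epsilon>(1) by (intro order_tendstoD) auto
  moreover have "\<forall>\<^sub>F x in F. turns_fairly X Y x \<longrightarrow> swept X (line_dir X Y (q x) (w x) * cnj e) < swept X (line_dir X Y q0 w0 * cnj e) + \<epsilon>"
    using eventually_swept_lt[OF tendsto_first_turn, of X Y X "swept X (line_dir X Y q0 w0 * cnj e) + \<epsilon>"] \<epsilon>(1)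
    by (auto simp: norm_mult n norm_e first turns_fairly_def elim!: eventually_mono)
  moreover have "\<forall>\<^sub>F x in F. turns_fairly X Y x \<longrightarrow> swept Y (w x * cnj (line_dir X Y (q x) (w x))) < swept Y (w0 * cnj (line_dir X Y q0 w0)) + \<epsilon>"
    using eventually_swept_lt[OF tendsto_last_turn, of X Y Y "swept Y (w0 * cnj (line_dir X Y q0 w0)) + \<epsilon>"] \<epsilon>(1)
    by (auto simp: norm_mult n norm_w0 last turns_fairly_def elim!: eventually_mono)
  ultimately show ?thesis
  proof eventually_elim
    case (elim x)
    show ?case
    proof
      assume "turns_fairly X Y x"
      then have "swept X (line_dir X Y (q x) (w x) * cnj e) < swept X (line_dir X Y q0 w0 * cnj e) + \<epsilon>"
        "swept Y (w x * cnj (line_dir X Y (q x) (w x))) < swept Y (w0 * cnj (line_dir X Y q0 w0)) + \<epsilon>"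
        using elim by auto
      from this[THEN mult_strict_left_mono[OF _ radius_pos]] elim(1)
      show "route_length X Y (q x) (w x) < y"
        unfolding \<epsilon>(2) route_length_def distrib_left by linarith
    qed
  qed
qed

text \<open>
  The four types all have the straight line as their limit. Their turns are small, so that two turns of the
  same sign add up to a total turn of that sign, which is what \<open>ex_fair_word\<close> asks for.
\<close>
lemma eventually_ex_fair_straight:
  assumes "w0 = e" "line_dir X Y q0 w0 = e"
  shows "\<forall>\<^sub>F x in F. \<exists>X Y. turns_fairly X Y x"
proof -
  have dir0: "line_dir X' Y' q0 w0 = e" for X' Y'
  proof -
    have "line_dir X' Y q0 w0 = w0" using line_from_start_indep(2)[OF norm_w0 far0 assms(2)] assms(1) by simp
    then show ?thesis using line_to_end_indep(2)[OF norm_w0 far0] assms(1) by simp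
  qed
  define a where "a X Y x = Im (line_dir X Y (q x) (w x) * cnj e)" for X Y x
  define b where "b X Y x = Im (w x * cnj (line_dir X Y (q x) (w x)))" for X Y x
  define h where "h x = Im (w x * cnj e)" for x
  have fair: "turns_fairly X Y x \<longleftrightarrow> 0 \<le> turn_sign X * a X Y x \<and> 0 \<le> turn_sign Y * b X Y x" for X Y x
    unfolding turns_fairly_def a_def b_def using dir0[of X Y] assms(1) by simp
  have sgns: "\<forall>\<^sub>F x in F. sgn (a X Y x) = sgn (start_side Y (q x) (w x)) \<and>
      sgn (b X Y x) = - sgn (end_side X (q x) (w x)) \<and>
      (0 < a X Y x \<and> 0 < b X Y x \<longrightarrow> 0 < h x) \<and> (a X Y x < 0 \<and> b X Y x < 0 \<longrightarrow> h x < 0)" for X Y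
  proof -
    have "((\<lambda>x. Re (line_dir X Y (q x) (w x) * cnj e)) \<longlongrightarrow> Re 1) F"
      "((\<lambda>x. Re (w x * cnj (line_dir X Y (q x) (w x)))) \<longlongrightarrow> Re 1) F"
      using tendsto_Re[OF tendsto_first_turn[of X Y]] tendsto_Re[OF tendsto_last_turn[of X Y]]
        dir0[of X Y] assms(1)
      by (simp_all add: mult_cnj_unit norm_e)
    then have "\<forall>\<^sub>F x in F. 0 < Re (line_dir X Y (q x) (w x) * cnj e)"
      "\<forall>\<^sub>F x in F. 0 < Re (w x * cnj (line_dir X Y (q x) (w x)))"
      by (auto intro: order_tendstoD)
    moreover have "\<forall>\<^sub>F x in F. sgn (a X Y x) = sgn (start_side Y (q x) (w x))"
      unfolding a_def by (rule eventually_sgn_first_turn) (rule dir0)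
    moreover have "\<forall>\<^sub>F x in F. sgn (b X Y x) = - sgn (end_side X (q x) (w x))"
      unfolding b_def by (rule eventually_sgn_last_turn) (use dir0[of X Y] assms(1) in simp)
    ultimately show ?thesis
    proof eventually_elim
      case (elim x)
      let ?u = "line_dir X Y (q x) (w x)"
      have "w x * cnj e = (w x * cnj ?u) * (?u * cnj e)"
        using mult_cnj_unit[OF norm_line_dir[OF norm_w far], of X Y x]
        by (metis (no_types, lifting) mult.assoc mult.commute mult.right_neutral)
      then have "h x = Re (w x * cnj ?u) * a X Y x + b X Y x * Re (?u * cnj e)"
        unfolding h_def a_def b_def by (simp only: times_complex.sel(2))
      moreover have "0 < h x" if "0 < a X Y x" "0 < b X Y x"
        unfolding calculation using that elim by (intro add_pos_pos mult_pos_pos) auto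
      moreover have "h x < 0" if "a X Y x < 0" "b X Y x < 0"
        unfolding calculation(1) using that elim by (intro add_neg_neg mult_pos_neg mult_neg_pos) auto
      ultimately show ?case using elim by blast
    qed
  qed
  have "\<forall>\<^sub>F x in F. \<forall>X Y. sgn (a X Y x) = sgn (start_side Y (q x) (w x)) \<and>
      sgn (b X Y x) = - sgn (end_side X (q x) (w x)) \<and>
      (0 < a X Y x \<and> 0 < b X Y x \<longrightarrow> 0 < h x) \<and> (a X Y x < 0 \<and> b X Y x < 0 \<longrightarrow> h x < 0)"
    by (intro eventually_all_turns sgns)
  then show ?thesis
  proof eventually_elim
    case (elim x)
    show ?case
      unfolding fair
      by (rule ex_fair_word[of "\<lambda>X Y. a X Y x" "\<lambda>Y. start_side Y (q x) (w x)"
            "\<lambda>X Y. b X Y x" "\<lambda>X. end_side X (q x) (w x)" "h x"])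
         (use elim in blast)+
  qed
qed

text \<open>
  If only one arc vanishes in the limit, both choices of its turn have the same limit path, and one of them is
  right for the nearby target. The other arc keeps away from angle \<open>0\<close>, so that it imposes no condition.
\<close>
lemma eventually_ex_fair:
  "\<forall>\<^sub>F x in F. \<exists>X' Y'. route_length X' Y' q0 w0 = route_length X Y q0 w0 \<and> turns_fairly X' Y' x"
proof -
  let ?u = "line_dir X Y q0 w0"
  consider (neither) "?u \<noteq> e" "?u \<noteq> w0" | (first) "?u = e" "e \<noteq> w0" | (last) "?u = w0" "e \<noteq> w0"
    | (both) "?u = e" "w0 = e" by metis
  then show ?thesis
  proof cases
    case neither
    then show ?thesis by (intro always_eventually allI exI[of _ X] exI[of _ Y]) (simp add: turns_fairly_def)
  next
    case first
    note indep = line_from_start_indep[OF norm_w0 far0 first(1)]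
    have same: "route_length X' Y q0 w0 = route_length X Y q0 w0" for X'
      using indep first by (simp add: route_length_def mult_cnj_unit norm_e)
    have "\<forall>\<^sub>F x in F. \<forall>X'. sgn (Im (line_dir X' Y (q x) (w x) * cnj e)) = sgn (start_side Y (q x) (w x))"
      by (intro eventually_all_turns eventually_sgn_first_turn indep)
    then show ?thesis
    proof eventually_elim
      case (elim x)
      obtain X' where X': "0 \<le> turn_sign X' * start_side Y (q x) (w x)" using ex_turn_sign by blast
      have "sgn (Im (line_dir X' Y (q x) (w x) * cnj e)) = sgn (start_side Y (q x) (w x))"
        using elim ..
      then have "0 \<le> turn_sign X' * Im (line_dir X' Y (q x) (w x) * cnj e)"
        using X' by (cases X') (auto simp: sgn_real_def split: if_splits)
      then have "turns_fairly X' Y x"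
        using indep first by (simp add: turns_fairly_def)
      with same show ?case by blast
    qed
  next
    case last
    note indep = line_to_end_indep[OF norm_w0 far0 last(1)]
    have same: "route_length X Y' q0 w0 = route_length X Y q0 w0" for Y'
      using indep last by (simp add: route_length_def mult_cnj_unit norm_w0)
    have "\<forall>\<^sub>F x in F. \<forall>Y'. sgn (Im (w x * cnj (line_dir X Y' (q x) (w x)))) = - sgn (end_side X (q x) (w x))"
      by (intro eventually_all_turns eventually_sgn_last_turn indep)
    then show ?thesis
    proof eventually_elim
      case (elim x)
      obtain Y' where Y': "0 \<le> turn_sign Y' * (- end_side X (q x) (w x))" using ex_turn_sign by blast
      have "sgn (Im (w x * cnj (line_dir X Y' (q x) (w x)))) = - sgn (end_side X (q x) (w x))"
        using elim ..
      then have "0 \<le> turn_sign Y' * Im (w x * cnj (line_dir X Y' (q x) (w x)))"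
        using Y' by (cases Y') (auto simp: sgn_real_def split: if_splits)
      then have "turns_fairly X Y' x"
        using indep last by (simp add: turns_fairly_def)
      with same show ?case by blast
    qed
  next
    case both
    have len: "line_length X' Y' q0 w0 = line_length X Y q0 w0" "line_dir X' Y' q0 w0 = e" for X' Y'
    proof -
      note start = line_from_start_indep[OF norm_w0 far0 both(1), of X']
      then have "line_dir X' Y q0 w0 = w0" using both by simp
      from line_to_end_indep[OF norm_w0 far0 this, of Y'] start
      show "line_length X' Y' q0 w0 = line_length X Y q0 w0" "line_dir X' Y' q0 w0 = e"
        using both by simp_all
    qed
    then have "route_length X' Y' q0 w0 = route_length X Y q0 w0" for X' Y'
      using both by (simp add: route_length_def mult_cnj_unit norm_e)
    then show ?thesis
      using eventually_ex_fair_straight[of X Y] both by auto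
  qed
qed

lemma tendsto_shortest: "((\<lambda>x. shortest (q x) (w x)) \<longlongrightarrow> shortest q0 w0) F"
proof (rule order_tendstoI)
  fix y
  assume "y < shortest q0 w0"
  then have "y < route_length X Y q0 w0" for X Y
    by (cases X; cases Y) (auto simp: shortest_def)
  then have gt: "\<forall>\<^sub>F x in F. y < route_length X Y (q x) (w x)" for X Y
    by (rule eventually_route_length_gt)
  have "\<forall>\<^sub>F x in F. \<forall>X Y. y < route_length X Y (q x) (w x)"
    by (intro eventually_all_turns gt)
  then show "\<forall>\<^sub>F x in F. y < shortest (q x) (w x)"
    by eventually_elim (simp add: shortest_def)
next
  fix y
  assume less: "shortest q0 w0 < y"
  have "shortest q0 w0 \<in> {route_length LeftTurn LeftTurn q0 w0, route_length LeftTurn RightTurn q0 w0,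
     route_length RightTurn RightTurn q0 w0, route_length RightTurn LeftTurn q0 w0}"
    unfolding shortest_def by (rule Min_in) auto
  then obtain X Y where XY: "route_length X Y q0 w0 = shortest q0 w0" by fastforce
  have lt: "\<forall>\<^sub>F x in F. route_length X' Y' q0 w0 < y \<longrightarrow> turns_fairly X' Y' x \<longrightarrow> route_length X' Y' (q x) (w x) < y" for X' Y'
    by (cases "route_length X' Y' q0 w0 < y") (auto dest: eventually_route_length_lt)
  have "\<forall>\<^sub>F x in F. \<forall>X' Y'. route_length X' Y' q0 w0 < y \<longrightarrow> turns_fairly X' Y' x \<longrightarrow> route_length X' Y' (q x) (w x) < y"
    by (intro eventually_all_turns lt)
  then show "\<forall>\<^sub>F x in F. shortest (q x) (w x) < y"
    using eventually_ex_fair[of X Y]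
  proof eventually_elim
    case (elim x)
    from elim(2) obtain X' Y' where "route_length X' Y' q0 w0 < y" "turns_fairly X' Y' x"
      using XY less by metis
    with elim(1) have "route_length X' Y' (q x) (w x) < y" by blast
    then show ?case
      by (cases X'; cases Y') (auto simp: shortest_def)
  qed
qed

end

section \<open>The shortest path to the target circle\<close>

text \<open>
  Given the turning centres, \<open>offset_eq_iff\<close> leaves one choice for the segment, and its direction leaves
  one choice for each arc. In particular the definite description in \<^const>\<open>csc_params\<close> is meaningful.
\<close>
lemma ex_csc_path_iff_closed_form:
  fixes \<theta> \<theta>' :: real and p q :: complex and W :: csc_word
  assumes "\<rho> > 0" and far: "4 * \<rho> < dist p q"
  defines "X \<equiv> first_turn W" and "Y \<equiv> last_turn W"
  defines "l \<equiv> initial_pose.line_length \<rho> p (cis \<theta>) X Y q (cis \<theta>')"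
    and "u \<equiv> initial_pose.line_dir \<rho> p (cis \<theta>) X Y q (cis \<theta>')"
  shows "(\<exists>\<gamma>. is_csc_path W \<rho> p \<theta> q \<theta>' a b c \<gamma>) \<longleftrightarrow>
    a = swept X (u * cnj (cis \<theta>)) \<and> b = l \<and> c = swept Y (cis \<theta>' * cnj u)"
    (is "?path \<longleftrightarrow> ?closed")
proof -
  interpret initial_pose \<rho> p "cis \<theta>"
    by unfold_locales (use assms in auto)
  have far': "norm (cis \<theta>') = 1" "4 * \<rho> < dist p q" using far by auto
  have u: "norm u = 1" and l: "0 < l"
    using norm_line_dir[OF far'] line_length_pos[OF far'] by (simp_all add: u_def l_def)
  show ?thesis
  proof (cases "a \<in> {0..<2 * pi} \<and> 0 \<le> b \<and> c \<in> {0..<2 * pi}")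
    case False
    then show ?thesis
      using swept_bounds l unfolding is_csc_path_def by (metis less_imp_le)
  next
    case True
    define \<psi> where "\<psi> = \<theta> + turn_sign X * a"
    have cis_add_eq: "cis (x + y) = z \<longleftrightarrow> cis y = z * cnj (cis x)" for x y z
      by (metis cis_mult mult.assoc mult.commute mult.right_neutral mult_cnj_unit norm_cis)
    have "?path \<longleftrightarrow> cis (\<psi> + turn_sign Y * c) = cis \<theta>' \<and>
        centre_shift X Y q (cis \<theta>') = Complex b (tangent_offset X Y) * cis \<psi>"
      using ex_csc_path_iff[of \<rho> a b c W p \<theta> q \<theta>'] True assms(1)
      by (simp add: Let_def X_def Y_def \<psi>_def centre_shift_def tangent_offset_def)
    also have "\<dots> \<longleftrightarrow> cis (\<psi> + turn_sign Y * c) = cis \<theta>' \<and> b = l \<and> cis \<psi> = u"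
      using offset_eq_iff[OF tangent_offset_less[OF far', of X Y], of b "cis \<psi>"] True
      by (simp add: l_def u_def line_length_def line_dir_def)
    also have "\<dots> \<longleftrightarrow> cis (turn_sign Y * c) = cis \<theta>' * cnj u \<and> b = l \<and> cis (turn_sign X * a) = u * cnj (cis \<theta>)"
      using cis_add_eq[of \<psi> "turn_sign Y * c" "cis \<theta>'"] cis_add_eq[of \<theta> "turn_sign X * a" u]
      unfolding \<psi>_def[symmetric] by metis
    also have "\<dots> \<longleftrightarrow> ?closed"
      using cis_turn_eq_iff[of "u * cnj (cis \<theta>)" a X] cis_turn_eq_iff[of "cis \<theta>' * cnj u" c Y] True u
      by (auto simp: norm_mult)
    finally show ?thesis .
  qed
qed

lemma csc_length_eq_route_length:
  assumes "\<rho> > 0" "4 * \<rho> < dist p (target_point Ct rt \<alpha>)"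
  shows "csc_length W \<rho> p \<theta> Ct rt \<alpha> =
    initial_pose.route_length \<rho> p (cis \<theta>) (first_turn W) (last_turn W) (target_point Ct rt \<alpha>) (cis (\<alpha> - pi / 2))"
proof -
  interpret initial_pose \<rho> p "cis \<theta>"
    by unfold_locales (use assms in auto)
  let ?X = "first_turn W" and ?Y = "last_turn W" and ?q = "target_point Ct rt \<alpha>" and ?w = "cis (\<alpha> - pi / 2)"
  let ?u = "line_dir ?X ?Y ?q ?w"
  have "csc_params W \<rho> p \<theta> Ct rt \<alpha> =
      (swept ?X (?u * cnj (cis \<theta>)), line_length ?X ?Y ?q ?w, swept ?Y (?w * cnj ?u))"
    unfolding csc_params_def ex_csc_path_iff_closed_form[OF assms]
    by (rule the_equality) auto
  then show ?thesis
    by (simp add: csc_length_def route_length_def)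
qed

lemma D_CSC_eq_shortest:
  assumes "\<rho> > 0" "4 * \<rho> < dist p (target_point Ct rt \<alpha>)"
  shows "D_CSC \<rho> p \<theta> Ct rt \<alpha> = initial_pose.shortest \<rho> p (cis \<theta>) (target_point Ct rt \<alpha>) (cis (\<alpha> - pi / 2))"
proof -
  interpret initial_pose \<rho> p "cis \<theta>"
    by unfold_locales (use assms in auto)
  show ?thesis
    by (simp add: D_CSC_def shortest_def csc_length_eq_route_length[OF assms])
qed

theorem theorem1:
  fixes \<rho> r\<^sub>t \<theta>\<^sub>i :: real and p\<^sub>i C\<^sub>t :: complex
  assumes "\<rho> > 0"
    and "r\<^sub>t = \<rho>"
    and "\<forall>q\<in>sphere C\<^sub>t r\<^sub>t. dist p\<^sub>i q > 4 * \<rho>"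
  shows "continuous_on {0..2 * pi} (D_CSC \<rho> p\<^sub>i \<theta>\<^sub>i C\<^sub>t r\<^sub>t)"
proof -
  let ?q = "target_point C\<^sub>t r\<^sub>t" and ?w = "\<lambda>\<alpha>. cis (\<alpha> - pi / 2)"
  have "?q \<alpha> \<in> sphere C\<^sub>t r\<^sub>t" for \<alpha>
    using assms(1,2) by (simp add: target_point_def dist_norm norm_mult)
  then have far: "4 * \<rho> < dist p\<^sub>i (?q \<alpha>)" for \<alpha>
    using assms(3) by blast
  interpret initial_pose \<rho> p\<^sub>i "cis \<theta>\<^sub>i"
    by unfold_locales (use assms in auto)
  have "((\<lambda>\<alpha>. shortest (?q \<alpha>) (?w \<alpha>)) \<longlongrightarrow> shortest (?q \<beta>) (?w \<beta>)) (at \<beta> within {0..2 * pi})" for \<beta>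
  proof -
    interpret moving_target \<rho> p\<^sub>i "cis \<theta>\<^sub>i" "at \<beta> within {0..2 * pi}" ?q ?w "?q \<beta>" "?w \<beta>"
      by unfold_locales (auto simp: target_point_def[abs_def] far[unfolded target_point_def] intro!: tendsto_intros)
    show ?thesis by (rule tendsto_shortest)
  qed
  then show ?thesis
    unfolding continuous_on_def D_CSC_eq_shortest[OF assms(1) far] by blast
qed

end
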